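(* Let $q$ be a power of an odd prime $p$, and for $k\ge 0$ let $T_k$ be the central trinomial coefficient, i.e.\ the coefficient of $x^k$ in $(1+x+x^2)^k$. Then in $\mathbb{Z}[x]$, \[ \sum_{k=0}^{q-1}T_kx^k\equiv(1-2x-3x^2)^{(q-1)/2}\pmod{p}. \] *)

theory Defs
  imports "HOL-Computational_Algebra.Computational_Algebra"
begin

definition central_trinomial :: "nat \<Rightarrow> int" where
  "central_trinomial k = coeff ([:1, 1, 1:] ^ k) k"

text \<open>
  Congruence in the polynomial ring over the integers modulo the ideal generated by the integer
  \<open>m\<close>. The library's \<open>cong\<close> is not available here, since \<open>int poly\<close> has no \<open>mod\<close> operation.
\<close>

definition int_poly_cong :: "int poly \<Rightarrow> int poly \<Rightarrow> int \<Rightarrow> bool" where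
  "int_poly_cong f g m \<longleftrightarrow> of_int m dvd f - g"

end

theory Submission
  imports Defs
begin

text \<open>
  Write \<open>D = 1 - 2 x - 3 x\<^sup>2\<close>, \<open>P = D ^ ((q - 1) div 2)\<close> and let \<open>G\<close> be the generating function of the
  central trinomial coefficients, so that \<open>G\<^sup>2 D = 1\<close>. On the other hand \<open>P\<^sup>2 D = D ^ q\<close> is
  congruent to \<open>1\<close> modulo \<open>p\<close> and \<open>x ^ q\<close> by the Frobenius identity. Hence
  \<open>(P - G) (P + G) D\<close> vanishes modulo \<open>p\<close> and \<open>x ^ q\<close>. As \<open>(P + G) D\<close> has constant term \<open>2\<close>, which
  is a unit modulo \<open>p\<close>, so does \<open>P - G\<close>; and \<open>P\<close> has degree less than \<open>q\<close>.
\<close>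

subsection \<open>The Frobenius identity modulo a prime\<close>

lemma prime_dvd_add_power_diff:
  fixes x y :: "'a :: comm_ring_1"
  assumes "prime p"
  shows "of_nat p dvd (x + y) ^ p - (x ^ p + y ^ p)"
proof -
  have p: "p > 0"
    using assms by (simp add: prime_gt_0_nat)
  have "(x + y) ^ p = (\<Sum>k\<le>p. of_nat (p choose k) * x ^ k * y ^ (p - k))"
    by (rule binomial_ring)
  also have "{..p} = insert 0 (insert p {0<..<p})"
    using p by auto
  also have "(\<Sum>k\<in>\<dots>. of_nat (p choose k) * x ^ k * y ^ (p - k)) =
      x ^ p + y ^ p + (\<Sum>k\<in>{0<..<p}. of_nat (p choose k) * x ^ k * y ^ (p - k))"
    using p by (simp add: algebra_simps)
  finally have "(x + y) ^ p - (x ^ p + y ^ p) =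
      (\<Sum>k\<in>{0<..<p}. of_nat (p choose k) * x ^ k * y ^ (p - k))"
    by simp
  moreover have "of_nat p dvd of_nat (p choose k) * x ^ k * y ^ (p - k)"
    if "k \<in> {0<..<p}" for k
  proof -
    have "p dvd (p choose k)"
      using that assms by (intro dvd_choose_prime) auto
    then have "(of_nat p :: 'a) dvd of_nat (p choose k)"
      by (metis dvd_def of_nat_mult)
    then show ?thesis
      by (simp add: mult.assoc)
  qed
  ultimately show ?thesis
    by (metis (no_types, lifting) dvd_sum)
qed

lemma prime_dvd_add_prime_power_diff:
  fixes x y :: "'a :: comm_ring_1"
  assumes "prime p"
  shows "of_nat p dvd (x + y) ^ (p ^ a) - (x ^ (p ^ a) + y ^ (p ^ a))"
proof (induction a)
  case 0
  show ?case by simp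
next
  case (Suc a)
  let ?u = "(x + y) ^ (p ^ a)" and ?v = "x ^ (p ^ a) + y ^ (p ^ a)"
  have "?u - ?v dvd ?u ^ p - ?v ^ p"
    by (simp add: power_diff_sumr2)
  then have "of_nat p dvd ?u ^ p - ?v ^ p"
    using Suc.IH dvd_trans by blast
  moreover have "of_nat p dvd ?v ^ p - ((x ^ (p ^ a)) ^ p + (y ^ (p ^ a)) ^ p)"
    by (rule prime_dvd_add_power_diff[OF assms])
  ultimately have "of_nat p dvd
      (?u ^ p - ?v ^ p) + (?v ^ p - ((x ^ (p ^ a)) ^ p + (y ^ (p ^ a)) ^ p))"
    by (rule dvd_add)
  then have "of_nat p dvd ?u ^ p - ((x ^ (p ^ a)) ^ p + (y ^ (p ^ a)) ^ p)"
    by (simp only: diff_add_cancel add_diff_eq)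
  then show ?case
    by (simp only: power_mult [symmetric] power_Suc2)
qed

lemma dvd_fps_nth_of_mult:
  fixes A B :: "int fps"
  assumes "coprime m (B $ 0)" and "\<And>k. k < q \<Longrightarrow> m dvd (A * B) $ k" and "k < q"
  shows "m dvd A $ k"
  using assms(3)
proof (induction k rule: less_induct)
  case (less k)
  have "(A * B) $ k = (\<Sum>i=0..k. A $ i * B $ (k - i))"
    by (rule fps_mult_nth)
  also have "{0..k} = insert k {0..<k}"
    by auto
  finally have "(A * B) $ k = A $ k * B $ 0 + (\<Sum>i=0..<k. A $ i * B $ (k - i))"
    by simp
  moreover have "m dvd (\<Sum>i=0..<k. A $ i * B $ (k - i))"
    using less by (intro dvd_sum) auto
  ultimately have "m dvd A $ k * B $ 0"
    using assms(2)[OF less.prems] by (metis dvd_add_left_iff)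
  then show ?case
    using assms(1) by (simp add: coprime_dvd_mult_left_iff)
qed

subsection \<open>The generating function of the central trinomial coefficients\<close>

definition aerated_binomial :: "nat \<Rightarrow> int" where
  "aerated_binomial i = (if even i then of_nat (i choose (i div 2)) else 0)"

lemma coeff_one_plus_square_power:
  "coeff ([:1, 0, 1:] ^ i) i = aerated_binomial i"
proof -
  have "[:1, 0, 1:] = (monom 1 2 + 1 :: int poly)"
    by (simp add: monom_altdef power2_eq_square one_pCons)
  then have "([:1, 0, 1:] :: int poly) ^ i = (\<Sum>j\<le>i. of_nat (i choose j) * monom 1 (2 * j))"
    by (simp add: binomial_ring monom_power mult.commute)
  then have "coeff ([:1, 0, 1:] ^ i) i = (\<Sum>j\<le>i. if 2 * j = i then int (i choose j) else 0)"
    by (simp add: coeff_sum of_nat_poly smult_monom if_distrib cong: if_cong)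
  also have "\<dots> = aerated_binomial i"
  proof (cases "even i")
    case True
    then have "(2 * j = i) = (j = i div 2)" for j
      by auto
    then show ?thesis
      using True by (simp add: aerated_binomial_def)
  next
    case False
    then have "2 * j \<noteq> i" for j
      by auto
    then show ?thesis
      using False by (simp add: aerated_binomial_def)
  qed
  finally show ?thesis .
qed

lemma central_trinomial_eq_sum:
  "central_trinomial k = (\<Sum>i=0..k. int (k choose i) * aerated_binomial i)"
proof -
  have "([:1, 1, 1:] :: int poly) = [:1, 0, 1:] + monom 1 1"
    by (simp add: monom_altdef)
  then have "([:1, 1, 1:] :: int poly) ^ k =
      (\<Sum>i\<le>k. of_nat (k choose i) * (monom 1 (k - i) * [:1, 0, 1:] ^ i))"
    by (simp add: binomial_ring monom_power mult_ac)
  then have "central_trinomial k =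
      (\<Sum>i\<le>k. coeff (of_nat (k choose i) * (monom 1 (k - i) * [:1, 0, 1:] ^ i)) k)"
    by (simp add: central_trinomial_def coeff_sum)
  also have "\<dots> = (\<Sum>i\<le>k. int (k choose i) * aerated_binomial i)"
    by (intro sum.cong refl)
       (simp add: of_nat_poly coeff_monom_mult
          coeff_one_plus_square_power)
  finally show ?thesis
    by (simp add: atMost_atLeast0)
qed

lemma aerated_binomial_rec:
  "int (n + 2) * aerated_binomial (n + 2) = 4 * int (n + 1) * aerated_binomial n"
proof (cases "even n")
  case True
  then obtain m where n: "n = 2 * m" by blast
  have "Suc m * ((2 * m + 2) choose Suc m) = (2 * m + 2) * ((2 * m + 1) choose m)"
    using Suc_times_binomial[of m "2 * m + 1"] by simp
  moreover have "Suc m * ((2 * m + 1) choose m) = (2 * m + 1) * ((2 * m) choose m)"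
    using binomial_absorb_comp[of "2 * m + 1" m] by simp
  moreover have "s * ((2 * m + 2) * A) = s * (4 * (2 * m + 1) * C)"
    if "s * A = (2 * m + 2) * B" "s * B = (2 * m + 1) * C" "s = Suc m" for s A B C
  proof -
    have "s * ((2 * m + 2) * A) = (2 * m + 2) * (s * A)"
      by (rule mult.left_commute)
    also have "\<dots> = 2 * (2 * m + 2) * (s * B)"
      unfolding that(1) by (simp add: that(3) algebra_simps)
    also have "\<dots> = s * (4 * (2 * m + 1) * C)"
      unfolding that(2) by (simp add: that(3) algebra_simps)
    finally show ?thesis .
  qed
  ultimately have "Suc m * ((2 * m + 2) * ((2 * m + 2) choose Suc m)) =
      Suc m * (4 * (2 * m + 1) * ((2 * m) choose m))"
    by blast
  then have "(2 * m + 2) * ((2 * m + 2) choose Suc m) = 4 * (2 * m + 1) * ((2 * m) choose m)"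
    by (simp only: mult_cancel1) simp
  then have "int ((2 * m + 2) * ((2 * m + 2) choose Suc m)) =
      int (4 * (2 * m + 1) * ((2 * m) choose m))"
    by (rule arg_cong)
  then show ?thesis
    unfolding n of_nat_mult by (simp add: aerated_binomial_def del: binomial_Suc_Suc)
qed (simp add: aerated_binomial_def)

lemma fps_aerated_binomial_square:
  "(Abs_fps aerated_binomial)\<^sup>2 * (1 - 4 * fps_X\<^sup>2) = 1"
proof -
  define E where "E = Abs_fps aerated_binomial"
  define Q :: "int fps" where "Q = 1 - 4 * fps_X\<^sup>2"
  have four: "(4 :: int fps) = fps_const 4"
    by (simp add: numeral_fps_const)
  have ode: "fps_deriv E * Q = 4 * fps_X * E"
  proof (rule fps_ext)
    fix n
    have "fps_deriv E * Q = fps_deriv E - 4 * (fps_X\<^sup>2 * fps_deriv E)"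
      by (simp add: Q_def algebra_simps)
    then have "(fps_deriv E * Q) $ n = fps_deriv E $ n - 4 * (fps_X\<^sup>2 * fps_deriv E) $ n"
      by (simp add: four)
    moreover have "(4 * fps_X * E) $ n = 4 * (fps_X * E) $ n"
      by (simp add: four mult.assoc)
    moreover have "fps_deriv E $ n - 4 * (fps_X\<^sup>2 * fps_deriv E) $ n = 4 * (fps_X * E) $ n"
    proof (cases n)
      case 0
      then show ?thesis
        by (simp add: E_def aerated_binomial_def fps_X_power_mult_nth)
    next
      case (Suc m)
      then show ?thesis
        using aerated_binomial_rec[of m] unfolding fps_X_power_mult_nth
        by (cases m) (simp_all add: E_def algebra_simps)
    qed
    ultimately show "(fps_deriv E * Q) $ n = (4 * fps_X * E) $ n"
      by simp
  qed
  have "fps_deriv (E\<^sup>2 * Q) = 2 * E * (fps_deriv E * Q) - E\<^sup>2 * (8 * fps_X)"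
    by (simp add: Q_def four power2_eq_square algebra_simps)
  also have "\<dots> = 0"
    unfolding ode by (simp add: power2_eq_square algebra_simps)
  finally have "E\<^sup>2 * Q = fps_const ((E\<^sup>2 * Q) $ 0)"
    by (simp only: fps_deriv_eq_0_iff)
  also have "(E\<^sup>2 * Q) $ 0 = 1"
    by (simp add: E_def Q_def aerated_binomial_def power2_eq_square)
  finally show ?thesis
    by (simp add: E_def Q_def)
qed

lemma fps_geometric_mult: "Abs_fps (\<lambda>_. 1) * (1 - fps_X) = (1 :: 'a :: comm_ring_1 fps)"
  by (rule fps_ext) (simp add: algebra_simps)

lemma fps_geometric_power_nth:
  fixes W :: "int fps"
  defines "W \<equiv> Abs_fps (\<lambda>_. 1)"
  shows "((fps_X * W) ^ i * W) $ k = int (k choose i)"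
proof -
  have W: "W * (1 - fps_X) = 1"
    unfolding W_def by (rule fps_geometric_mult)
  have "(fps_X * W) ^ i * W = Abs_fps (\<lambda>k. int (k choose i))"
  proof (induction i)
    case 0
    show ?case by (simp add: W_def)
  next
    case (Suc i)
    let ?B = "\<lambda>i. Abs_fps (\<lambda>k. int (k choose i))"
    have pascal: "?B (Suc i) * (1 - fps_X) = fps_X * ?B i"
    proof (rule fps_ext)
      fix k
      show "(?B (Suc i) * (1 - fps_X)) $ k = (fps_X * ?B i) $ k"
        by (cases k) (simp_all add: algebra_simps)
    qed
    have "(fps_X * W) ^ Suc i * W = W * (fps_X * ((fps_X * W) ^ i * W))"
      by (simp add: algebra_simps)
    also have "\<dots> = W * (?B (Suc i) * (1 - fps_X))"
      by (simp only: Suc.IH pascal)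
    also have "\<dots> = ?B (Suc i)"
      using W by (metis mult.assoc mult.commute mult_1)
    finally show ?case .
  qed
  then show ?thesis by simp
qed

text \<open>
  Binomial transforms correspond to the substitution \<open>A(x) \<mapsto> A(x / (1 - x)) / (1 - x)\<close>.
\<close>

lemma fps_central_trinomial_eq_compose:
  fixes W :: "int fps"
  defines "W \<equiv> Abs_fps (\<lambda>_. 1)"
  shows "Abs_fps central_trinomial = (Abs_fps aerated_binomial oo (fps_X * W)) * W"
proof (rule fps_ext)
  fix k
  let ?u = "fps_X * W" and ?e = aerated_binomial
  have nth: "(Abs_fps ?e oo ?u) $ m = (\<Sum>i=0..k. ?e i * (?u ^ i) $ m)" if "m \<le> k" for m
  proof -
    have "(?u ^ i) $ m = 0" if "m < i" for i
      using that by (simp add: power_mult_distrib fps_X_power_mult_nth)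
    then have "(\<Sum>i=0..m. ?e i * (?u ^ i) $ m) = (\<Sum>i=0..k. ?e i * (?u ^ i) $ m)"
      using \<open>m \<le> k\<close> by (intro sum.mono_neutral_left) auto
    then show ?thesis
      by (simp add: fps_compose_nth)
  qed
  have "((Abs_fps ?e oo ?u) * W) $ k =
      (\<Sum>m=0..k. \<Sum>i=0..k. ?e i * ((?u ^ i) $ m * W $ (k - m)))"
    unfolding fps_mult_nth[of _ W]
    by (intro sum.cong refl) (simp add: nth sum_distrib_right mult.assoc)
  also have "\<dots> = (\<Sum>i=0..k. ?e i * (?u ^ i * W) $ k)"
    unfolding fps_mult_nth[of _ W] sum_distrib_left by (rule sum.swap)
  also have "\<dots> = central_trinomial k"
    unfolding central_trinomial_eq_sum W_def fps_geometric_power_nth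
    by (simp add: mult.commute)
  finally show "Abs_fps central_trinomial $ k = ((Abs_fps ?e oo ?u) * W) $ k"
    by simp
qed

lemma fps_central_trinomial_square:
  "(Abs_fps central_trinomial)\<^sup>2 * fps_of_poly [:1, -2, -3:] = 1"
proof -
  define W :: "int fps" where "W = Abs_fps (\<lambda>_. 1)"
  define u where "u = fps_X * W"
  define F where "F = Abs_fps aerated_binomial oo u"
  have W: "W * (1 - fps_X) = 1"
    unfolding W_def by (rule fps_geometric_mult)
  have u0: "u $ 0 = 0"
    by (simp add: u_def)
  have "((Abs_fps aerated_binomial)\<^sup>2 * (1 - 4 * fps_X\<^sup>2)) oo u = 1 oo u"
    by (simp only: fps_aerated_binomial_square)
  then have F: "F\<^sup>2 * (1 - 4 * u\<^sup>2) = 1"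
    using u0
    by (simp add: F_def fps_compose_mult_distrib fps_compose_sub_distrib numeral_fps_const
        flip: fps_compose_power)
  have D: "fps_of_poly [:1, -2, -3 :: int:] = (1 - fps_X)\<^sup>2 - 4 * fps_X\<^sup>2"
    by (simp add: fps_of_poly_pCons numeral_fps_const[symmetric] power2_eq_square algebra_simps
        flip: fps_const_neg)
  have "(Abs_fps central_trinomial)\<^sup>2 * fps_of_poly [:1, -2, -3:] =
      F\<^sup>2 * ((W * (1 - fps_X))\<^sup>2 - 4 * u\<^sup>2)"
    unfolding fps_central_trinomial_eq_compose D F_def u_def W_def
    by (simp add: power2_eq_square algebra_simps)
  then show ?thesis
    using W F by simp
qed

subsection \<open>Comparison modulo \<open>p\<close> and \<open>x ^ q\<close>\<close>

lemma dvd_fps_power_minus_one_nth: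
  assumes "prime p" and "k < p ^ a"
  shows "int p dvd (fps_of_poly [:1, -2, -3:] ^ (p ^ a) - 1) $ k"
proof -
  define F :: "int fps" where "F = fps_X * fps_of_poly [:-2, -3:]"
  have D: "fps_of_poly [:1, -2, -3:] = 1 + F"
    by (simp add: F_def fps_of_poly_pCons algebra_simps)
  obtain R where "(1 + F) ^ (p ^ a) - (1 ^ (p ^ a) + F ^ (p ^ a)) = of_nat p * R"
    using prime_dvd_add_prime_power_diff[OF assms(1), of 1 F a] by (elim dvdE)
  then have "(1 + F) ^ (p ^ a) - 1 = F ^ (p ^ a) + of_nat p * R"
    by (simp add: algebra_simps)
  moreover have "(F ^ (p ^ a)) $ k = 0"
    using assms(2) by (simp add: F_def power_mult_distrib fps_X_power_mult_nth)
  moreover have "(of_nat p * R) $ k = int p * R $ k"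
    by (simp add: fps_of_nat[symmetric])
  ultimately show ?thesis
    by (simp add: D)
qed

lemma dvd_power_coeff_minus_central_trinomial:
  assumes "prime p" and "odd p" and "k < p ^ a"
  shows "int p dvd coeff ([:1, -2, -3:] ^ ((p ^ a - 1) div 2)) k - central_trinomial k"
proof -
  let ?q = "p ^ a"
  define n where "n = (?q - 1) div 2"
  define D :: "int fps" where "D = fps_of_poly [:1, -2, -3:]"
  define G where "G = Abs_fps central_trinomial"
  have q: "?q = Suc (2 * n)"
    using assms(2) by (simp add: n_def)
  have "(D ^ n - G) * ((D ^ n + G) * D) = D ^ ?q - G\<^sup>2 * D"
    by (simp add: q power2_eq_square power_mult power_mult_distrib algebra_simps)
  then have eq: "(D ^ n - G) * ((D ^ n + G) * D) = D ^ ?q - 1"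
    by (simp add: D_def G_def fps_central_trinomial_square)
  have "((D ^ n + G) * D) $ 0 = 2"
    by (simp add: D_def G_def central_trinomial_def fps_power_zeroth)
  moreover have "coprime (int p) 2"
    using assms(2) by simp
  ultimately have "coprime (int p) (((D ^ n + G) * D) $ 0)"
    by simp
  then have "int p dvd (D ^ n - G) $ k"
    by (rule dvd_fps_nth_of_mult[OF _ _ assms(3)])
       (simp only: eq, simp only: D_def dvd_fps_power_minus_one_nth assms(1))
  then show ?thesis
    by (simp add: D_def G_def n_def flip: fps_of_poly_power)
qed

theorem theorem2p4:
  fixes p q a :: nat
  assumes "prime p" and "odd p" and "a \<ge> 1" and "q = p ^ a"
  shows "int_poly_cong (\<Sum>k = 0..q - 1. monom (central_trinomial k) k)
           ([:1, -2, -3:] ^ ((q - 1) div 2)) (int p)"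
proof -
  let ?S = "\<Sum>k = 0..q - 1. monom (central_trinomial k) k"
  let ?P = "[:1, -2, -3 :: int:] ^ ((q - 1) div 2)"
  have q: "q > 0"
    using assms by (simp add: prime_gt_0_nat)
  have S: "coeff ?S k = (if k < q then central_trinomial k else 0)" for k
    using q by (auto simp: coeff_sum coeff_monom)
  have "int p dvd coeff (?S - ?P) k" for k
  proof (cases "k < q")
    case True
    then have "int p dvd coeff ?P k - central_trinomial k"
      using dvd_power_coeff_minus_central_trinomial[of p k a] assms by simp
    then show ?thesis
      using True unfolding coeff_diff S by (simp add: dvd_diff_commute)
  next
    case False
    have "degree ?P \<le> 2 * ((q - 1) div 2)"
      using degree_power_le[of "[:1, -2, -3 :: int:]" "(q - 1) div 2"] by simp
    also have "\<dots> < k"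
      using False q by linarith
    finally have "coeff ?P k = 0"
      by (rule coeff_eq_0)
    then show ?thesis
      using False unfolding coeff_diff S by simp
  qed
  then have "[:int p:] dvd ?S - ?P"
    unfolding const_poly_dvd_iff by blast
  then show ?thesis
    by (simp add: int_poly_cong_def of_nat_poly)
qed

end
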